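(* Let $\Omega\subset\mathbb C$ be a simply connected domain containing $0$ and let $g_0\in H(\Omega)$ satisfy $g_0(0)=1$. The operator $D_{0,g_0}$ is unicellular in $H(\Omega)$ if and only if $\Omega=\mathbb C$ and $g_0$ has no zeros in $\mathbb C$. If this is the case, then the proper closed $D_{0,g_0}$-invariant subspaces of $H(\Omega)$ are exactly the subspaces $g_0\mathbb C[z]_n$, $n\ge0$ an integer.
   Context: $H(\Omega)$ is the Fréchet space of all holomorphic functions on $\Omega$ with the topology of compact convergence. The generalized backward shift (Pommiez operator) is the continuous linear operator $D_{0,g_0}:H(\Omega)\to H(\Omega)$, $D_{0,g_0}(f)(t)=\frac{f(t)-g_0(t)f(0)}{t}$ for $t\ne0$, $D_{0,g_0}(f)(0)=f'(0)-g_0'(0)f(0)$. A subspace of $H(\Omega)$ is proper if it is neither $\{0\}$ nor $H(\Omega)$. A continuous linear operator is unicellular if the family of its closed invariant subspaces is linearly ordered by inclusion. $\mathbb C[z]_n$ is the set of complex polynomials of degree at most $n$, and $g_0\mathbb C[z]_n:=\{g_0q\,|\,q\in\mathbb C[z]_n\}$. *)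

theory Defs
  imports "HOL-Complex_Analysis.Complex_Analysis" "HOL-Library.Function_Algebras"
begin

definition cfun_scale :: "complex \<Rightarrow> (complex \<Rightarrow> complex) \<Rightarrow> complex \<Rightarrow> complex" where
  "cfun_scale c f = (\<lambda>z. c * f z)"

global_interpretation cfun: vector_space cfun_scale
  by standard (auto simp: cfun_scale_def algebra_simps fun_eq_iff)

text \<open>
  Elements of \<open>H(\<Omega>)\<close> are functions on \<open>\<Omega>\<close>. Each one is represented by its extension by \<open>0\<close>
  to the whole plane, so that equality of elements is equality of HOL functions and the vector
  space operations are the pointwise ones.
\<close>

definition hol_space :: "complex set \<Rightarrow> (complex \<Rightarrow> complex) set" where
  "hol_space \<Omega> = {f. f holomorphic_on \<Omega> \<and> (\<forall>z. z \<notin> \<Omega> \<longrightarrow> f z = 0)}"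

text \<open>The topology of compact convergence on \<open>H(\<Omega>)\<close>; its underlying set is all of \<open>H(\<Omega>)\<close>.\<close>

definition hol_topology :: "complex set \<Rightarrow> (complex \<Rightarrow> complex) topology" where
  "hol_topology \<Omega> = topology_generated_by
     {{g \<in> hol_space \<Omega>. \<forall>z\<in>K. cmod (g z - f z) < e} | f K e.
        f \<in> hol_space \<Omega> \<and> compact K \<and> K \<subseteq> \<Omega> \<and> 0 < e}"

definition continuous_linear_operator ::
    "complex set \<Rightarrow> ((complex \<Rightarrow> complex) \<Rightarrow> (complex \<Rightarrow> complex)) \<Rightarrow> bool" where
  "continuous_linear_operator \<Omega> T \<longleftrightarrow>
     continuous_map (hol_topology \<Omega>) (hol_topology \<Omega>) T \<and>
     (\<forall>f\<in>hol_space \<Omega>. \<forall>g\<in>hol_space \<Omega>. T (f + g) = T f + T g) \<and>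
     (\<forall>c. \<forall>f\<in>hol_space \<Omega>. T (cfun_scale c f) = cfun_scale c (T f))"

definition closed_invariant_subspace ::
    "complex set \<Rightarrow> ((complex \<Rightarrow> complex) \<Rightarrow> (complex \<Rightarrow> complex)) \<Rightarrow>
     (complex \<Rightarrow> complex) set \<Rightarrow> bool" where
  "closed_invariant_subspace \<Omega> T M \<longleftrightarrow>
     cfun.subspace M \<and> closedin (hol_topology \<Omega>) M \<and> T ` M \<subseteq> M"

definition proper_subspace :: "complex set \<Rightarrow> (complex \<Rightarrow> complex) set \<Rightarrow> bool" where
  "proper_subspace \<Omega> M \<longleftrightarrow>
     cfun.subspace M \<and> M \<subseteq> hol_space \<Omega> \<and> M \<noteq> {0} \<and> M \<noteq> hol_space \<Omega>"

definition unicellular ::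
    "complex set \<Rightarrow> ((complex \<Rightarrow> complex) \<Rightarrow> (complex \<Rightarrow> complex)) \<Rightarrow> bool" where
  "unicellular \<Omega> T \<longleftrightarrow>
     continuous_linear_operator \<Omega> T \<and>
     (\<forall>M N. closed_invariant_subspace \<Omega> T M \<and> closed_invariant_subspace \<Omega> T N \<longrightarrow>
        M \<subseteq> N \<or> N \<subseteq> M)"

text \<open>
  For \<open>f\<close> and \<open>g\<^sub>0\<close> in \<open>H(\<Omega>)\<close> with \<open>0 \<in> \<Omega>\<close>, the first branch below vanishes off \<open>\<Omega>\<close>, so no
  restriction to \<open>\<Omega>\<close> is needed.
\<close>

definition pommiez :: "(complex \<Rightarrow> complex) \<Rightarrow> (complex \<Rightarrow> complex) \<Rightarrow> complex \<Rightarrow> complex" where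
  "pommiez g\<^sub>0 f = (\<lambda>t. if t \<noteq> 0 then (f t - g\<^sub>0 t * f 0) / t
                          else deriv f 0 - deriv g\<^sub>0 0 * f 0)"

definition poly_multiples :: "(complex \<Rightarrow> complex) \<Rightarrow> nat \<Rightarrow> (complex \<Rightarrow> complex) set" where
  "poly_multiples g\<^sub>0 n = {g\<^sub>0 * poly q | q :: complex poly. degree q \<le> n}"

lemma topspace_hol_topology [simp]: "topspace (hol_topology \<Omega>) = hol_space \<Omega>"
  unfolding hol_topology_def topology_generated_by_topspace
proof (intro equalityI subsetI)
  fix f assume "f \<in> hol_space \<Omega>"
  then show "f \<in> \<Union>{{g \<in> hol_space \<Omega>. \<forall>z\<in>K. cmod (g z - f z) < e} | f K e.
        f \<in> hol_space \<Omega> \<and> compact K \<and> K \<subseteq> \<Omega> \<and> 0 < e}"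
    by (intro UnionI[of "{g \<in> hol_space \<Omega>. \<forall>z\<in>{}. cmod (g z - f z) < 1}"] CollectI exI[of _ f]
        exI[of _ "{}"] exI[of _ "1::real"]) auto
qed auto

lemma subspace_hol_space: "cfun.subspace (hol_space \<Omega>)"
  by (auto simp: cfun.subspace_def hol_space_def cfun_scale_def zero_fun_def plus_fun_def
      intro!: holomorphic_intros)

lemma pommiez_in_hol_space:
  assumes "open \<Omega>" "0 \<in> \<Omega>" "g\<^sub>0 \<in> hol_space \<Omega>" "g\<^sub>0 0 = 1" "f \<in> hol_space \<Omega>"
  shows "pommiez g\<^sub>0 f \<in> hol_space \<Omega>"
proof -
  have f: "f holomorphic_on \<Omega>" and g: "g\<^sub>0 holomorphic_on \<Omega>"
    using assms by (auto simp: hol_space_def)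
  define h where "h = (\<lambda>t. f t - g\<^sub>0 t * f 0)"
  have h: "h holomorphic_on \<Omega>"
    unfolding h_def by (intro holomorphic_intros f g)
  have df: "(f has_field_derivative deriv f 0) (at 0)" "(g\<^sub>0 has_field_derivative deriv g\<^sub>0 0) (at 0)"
    using f g assms(1,2) by (auto intro: holomorphic_derivI)
  have "(h has_field_derivative deriv f 0 - deriv g\<^sub>0 0 * f 0) (at 0)"
    unfolding h_def by (rule derivative_eq_intros df refl)+ simp
  then have "deriv h 0 = deriv f 0 - deriv g\<^sub>0 0 * f 0"
    by (rule DERIV_imp_deriv)
  then have "pommiez g\<^sub>0 f holomorphic_on \<Omega>"
    using assms(4) by (intro pole_theorem_open_0[OF h assms(1), of 0]) (auto simp: pommiez_def h_def)
  moreover have "pommiez g\<^sub>0 f z = 0" if "z \<notin> \<Omega>" for z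
    using that assms by (auto simp: pommiez_def hol_space_def)
  ultimately show ?thesis by (auto simp: hol_space_def)
qed

lemma pommiez_linear:
  assumes "open \<Omega>" "0 \<in> \<Omega>" "f \<in> hol_space \<Omega>" "g \<in> hol_space \<Omega>"
  shows "pommiez g\<^sub>0 (f + g) = pommiez g\<^sub>0 f + pommiez g\<^sub>0 g"
    and "pommiez g\<^sub>0 (cfun_scale c f) = cfun_scale c (pommiez g\<^sub>0 f)"
proof -
  have df: "(f has_field_derivative deriv f 0) (at 0)" "(g has_field_derivative deriv g 0) (at 0)"
    using assms by (auto simp: hol_space_def intro: holomorphic_derivI)
  have "deriv (f + g) 0 = deriv f 0 + deriv g 0"
    unfolding plus_fun_def by (intro DERIV_imp_deriv DERIV_add df)
  moreover have "deriv (cfun_scale c f) 0 = c * deriv f 0"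
    unfolding cfun_scale_def by (intro DERIV_imp_deriv DERIV_cmult df)
  ultimately show "pommiez g\<^sub>0 (f + g) = pommiez g\<^sub>0 f + pommiez g\<^sub>0 g"
    and "pommiez g\<^sub>0 (cfun_scale c f) = cfun_scale c (pommiez g\<^sub>0 f)"
    by (auto simp: pommiez_def fun_eq_iff cfun_scale_def field_simps)
qed

lemma pommiez_bound:
  assumes \<Omega>: "open \<Omega>" "0 \<in> \<Omega>" and g: "g\<^sub>0 \<in> hol_space \<Omega>" "g\<^sub>0 0 = 1" and f: "f \<in> hol_space \<Omega>"
    and r: "0 < r" "cball 0 r \<subseteq> L" "L \<subseteq> \<Omega>"
    and B: "\<And>z. z \<in> L \<Longrightarrow> cmod (g\<^sub>0 z) \<le> B"
    and E: "\<And>z. z \<in> L \<Longrightarrow> cmod (f z) \<le> E"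
    and z: "z \<in> L"
  shows "cmod (pommiez g\<^sub>0 f z) \<le> (E + B * E) / r"
proof -
  have L0: "0 \<in> L" using r by auto
  have nn: "0 \<le> B" "0 \<le> E"
    using B[OF L0] E[OF L0] norm_ge_zero order_trans by blast+
  have far: "cmod (pommiez g\<^sub>0 f z) \<le> (E + B * E) / r" if z: "z \<in> L" and rz: "r \<le> cmod z" for z
  proof -
    have "z \<noteq> 0" using rz r by auto
    have "cmod (f z - g\<^sub>0 z * f 0) \<le> cmod (f z) + cmod (g\<^sub>0 z) * cmod (f 0)"
      by (metis norm_mult norm_triangle_ineq4)
    also have "\<dots> \<le> E + B * E"
      using B E z L0 nn by (intro add_mono mult_mono) auto
    finally have *: "cmod (f z - g\<^sub>0 z * f 0) \<le> E + B * E" .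
    have "cmod (f z - g\<^sub>0 z * f 0) / cmod z \<le> (E + B * E) / r"
      using * rz r nn by (intro frac_le) auto
    then show ?thesis using \<open>z \<noteq> 0\<close> by (simp add: pommiez_def norm_divide)
  qed
  show ?thesis
  proof (cases "r \<le> cmod z")
    case True
    then show ?thesis using far z by blast
  next
    case False
    have hol: "pommiez g\<^sub>0 f holomorphic_on cball 0 r"
      using pommiez_in_hol_space[OF \<Omega> g f] r by (auto simp: hol_space_def intro: holomorphic_on_subset)
    show ?thesis
    proof (rule maximum_modulus_frontier[where f = "pommiez g\<^sub>0 f" and S = "cball 0 r"])
      show "pommiez g\<^sub>0 f holomorphic_on interior (cball 0 r)"
        using hol interior_subset holomorphic_on_subset by blast
      show "continuous_on (closure (cball 0 r)) (pommiez g\<^sub>0 f)"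
        using hol by (simp add: holomorphic_on_imp_continuous_on)
      show "cmod (pommiez g\<^sub>0 f w) \<le> (E + B * E) / r" if "w \<in> frontier (cball 0 r)" for w
        using that r by (intro far) auto
      show "z \<in> cball 0 r" using False by simp
    qed auto
  qed
qed

lemma pommiez_continuous_linear:
  assumes \<Omega>: "open \<Omega>" "0 \<in> \<Omega>" and g: "g\<^sub>0 \<in> hol_space \<Omega>" "g\<^sub>0 0 = 1"
  shows "continuous_linear_operator \<Omega> (pommiez g\<^sub>0)"
proof -
  let ?D = "pommiez g\<^sub>0"
  define nb where "nb = (\<lambda>f K e. {g \<in> hol_space \<Omega>. \<forall>z\<in>K. cmod (g z - f z) < e})"
  have nb_open: "openin (hol_topology \<Omega>) (nb f K e)"
    if "f \<in> hol_space \<Omega>" "compact K" "K \<subseteq> \<Omega>" "0 < e" for f K e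
    unfolding hol_topology_def nb_def using that by (intro topology_generated_by_Basis) blast
  have *: "openin (hol_topology \<Omega>) (?D -` nb h K e \<inter> hol_space \<Omega>)"
    if h: "h \<in> hol_space \<Omega>" and K: "compact K" "K \<subseteq> \<Omega>" and e: "0 < e" for h K e
  proof (subst openin_subopen, intro ballI)
    fix f assume "f \<in> ?D -` nb h K e \<inter> hol_space \<Omega>"
    then have f: "f \<in> hol_space \<Omega>" and fe: "\<And>z. z \<in> K \<Longrightarrow> cmod (?D f z - h z) < e"
      by (auto simp: nb_def)
    have Df: "?D f \<in> hol_space \<Omega>" by (rule pommiez_in_hol_space[OF \<Omega> g f])
    have cont: "continuous_on K u" if "u \<in> hol_space \<Omega>" "K \<subseteq> \<Omega>" for u K
      using that by (auto simp: hol_space_def intro: holomorphic_on_imp_continuous_on holomorphic_on_subset)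
    have "\<exists>m<e. \<forall>z\<in>K. cmod (?D f z - h z) \<le> m"
    proof (cases "K = {}")
      case True
      then show ?thesis using e by auto
    next
      case False
      have "continuous_on K (\<lambda>z. cmod (?D f z - h z))"
        by (intro continuous_intros cont Df h K)
      then obtain w where "w \<in> K" "\<forall>z\<in>K. cmod (?D f z - h z) \<le> cmod (?D f w - h w)"
        using continuous_attains_sup[OF K(1) False] by blast
      then show ?thesis using fe by blast
    qed
    then obtain m where m: "m < e" "\<And>z. z \<in> K \<Longrightarrow> cmod (?D f z - h z) \<le> m" by blast
    obtain r where r: "0 < r" "cball 0 r \<subseteq> \<Omega>" using \<Omega> open_contains_cball by blast
    define L where "L = K \<union> cball 0 r"
    have L: "compact L" "L \<subseteq> \<Omega>" "cball 0 r \<subseteq> L" "K \<subseteq> L"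
      using K r by (auto simp: L_def)
    have "bounded (g\<^sub>0 ` L)"
      using L cont[OF g(1) L(2)] by (intro compact_imp_bounded compact_continuous_image)
    then obtain B where B: "0 < B" "\<And>z. z \<in> L \<Longrightarrow> cmod (g\<^sub>0 z) \<le> B"
      by (auto simp: bounded_pos)
    define E where "E = (e - m) * r / (2 * (1 + B))"
    have E: "0 < E" using m r B by (simp add: E_def)
    have "(1 + B) * E = (e - m) * r / 2"
      using B by (simp add: E_def field_simps)
    then have EB: "(E + B * E) / r = (e - m) / 2"
      using r by (simp add: field_simps)
    show "\<exists>T. openin (hol_topology \<Omega>) T \<and> f \<in> T \<and> T \<subseteq> ?D -` nb h K e \<inter> hol_space \<Omega>"
    proof (intro exI conjI subsetI)
      show "openin (hol_topology \<Omega>) (nb f L E)" using nb_open f L E by blast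
      show "f \<in> nb f L E" using f E by (simp add: nb_def)
      fix k assume "k \<in> nb f L E"
      then have k: "k \<in> hol_space \<Omega>" and kE: "\<And>z. z \<in> L \<Longrightarrow> cmod (k z - f z) < E"
        by (auto simp: nb_def)
      define u where "u = k + cfun_scale (- 1) f"
      have sf: "cfun_scale (- 1) f \<in> hol_space \<Omega>"
        using f subspace_hol_space cfun.subspace_scale by blast
      have u: "u \<in> hol_space \<Omega>"
        unfolding u_def using k sf subspace_hol_space cfun.subspace_add by blast
      have Du: "?D u z = ?D k z - ?D f z" for z
        unfolding u_def pommiez_linear(1)[OF \<Omega> k sf] pommiez_linear(2)[OF \<Omega> f k]
        by (simp add: cfun_scale_def)
      have "cmod (?D k z - h z) < e" if z: "z \<in> K" for z
      proof -
        have uE: "cmod (u w) \<le> E" if "w \<in> L" for w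
          using kE[OF that] by (simp add: u_def cfun_scale_def)
        have "cmod (?D u z) \<le> (E + B * E) / r"
          by (rule pommiez_bound[OF \<Omega> g u r(1) L(3,2) B(2) uE]) (use z L in auto)
        then have "cmod (?D k z - ?D f z) \<le> (e - m) / 2" by (simp only: Du EB)
        then show ?thesis
          using m(1) m(2)[OF z] norm_triangle_ineq[of "?D k z - ?D f z" "?D f z - h z"] by simp
      qed
      then show "k \<in> ?D -` nb h K e \<inter> hol_space \<Omega>"
        using k pommiez_in_hol_space[OF \<Omega> g k] by (simp add: nb_def)
    qed
  qed
  have "continuous_map (hol_topology \<Omega>) (hol_topology \<Omega>) ?D"
    unfolding hol_topology_def[of \<Omega>] continuous_on_generated_topo_iff
    unfolding hol_topology_def[of \<Omega>, symmetric] topspace_hol_topology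
  proof (intro conjI allI impI)
    fix U
    assume "U \<in> {{g \<in> hol_space \<Omega>. \<forall>z\<in>K. cmod (g z - f z) < e} | f K e.
        f \<in> hol_space \<Omega> \<and> compact K \<and> K \<subseteq> \<Omega> \<and> 0 < e}"
    then show "openin (hol_topology \<Omega>) (?D -` U \<inter> hol_space \<Omega>)"
      using * unfolding nb_def by blast
  next
    show "?D ` hol_space \<Omega> \<subseteq> \<Union>{{g \<in> hol_space \<Omega>. \<forall>z\<in>K. cmod (g z - f z) < e} | f K e.
        f \<in> hol_space \<Omega> \<and> compact K \<and> K \<subseteq> \<Omega> \<and> 0 < e}"
      using pommiez_in_hol_space[OF \<Omega> g] topspace_hol_topology[of \<Omega>]
      unfolding hol_topology_def topology_generated_by_topspace by blast
  qed
  then show ?thesis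
    using pommiez_linear[OF \<Omega>] by (simp add: continuous_linear_operator_def)
qed

end

(* Off Omega the function g0 is zero, so the negation of "Omega = C and g0 has no zeros" gives
   a nonzero point a with g0(a) = 0. Then f = a g0 / (a - t) is an eigenvector for 1/a while g0 is
   an eigenvector for 0, and the lines spanned by them are incomparable.

   Conversely, let g0 be entire without zeros, so that D(g0 f) = g0 B f with B the classical backward
   shift. Let M be closed and invariant, g0 f in M, f = sum a_k z^k with a_m \<noteq> 0. For R large,
   choose j \<ge> m maximising |a_j| R^j; this exists because a_k R^k tends to 0. For n \<le> m,
   B^(j-n) f / a_j minus its terms of degree < n is then z^n up to a tail dominated by a geometric
   series of ratio r/R on |z| \<le> r. By induction on n, g0 z^n lies in M for all n \<le> m. Hence
   M is zero, some g0 C[z]_n, or everything. *)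

theory Submission
  imports Defs
begin

section \<open>Neighbourhoods in the topology of compact convergence\<close>

lemma openin_hol_topology_nbhd:
  assumes "f \<in> hol_space \<Omega>" "compact K" "K \<subseteq> \<Omega>" "0 < e"
  shows "openin (hol_topology \<Omega>) {g \<in> hol_space \<Omega>. \<forall>z\<in>K. cmod (g z - f z) < e}"
  unfolding hol_topology_def using assms by (intro topology_generated_by_Basis) blast

text \<open>The generating sets have arbitrary centres and form only a subbasis. Induction over the
  generation of \<open>U\<close> replaces them by a single uniform ball centred at \<open>h\<close>
  itself.\<close>

lemma hol_topology_nbhdE:
  assumes "openin (hol_topology \<Omega>) U" "h \<in> U"
  obtains K e where "compact K" "K \<subseteq> \<Omega>" "0 < e"
    "{g \<in> hol_space \<Omega>. \<forall>z\<in>K. cmod (g z - h z) < e} \<subseteq> U"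
proof -
  let ?N = "\<lambda>K e. {g \<in> hol_space \<Omega>. \<forall>z\<in>K. cmod (g z - h z) < e}"
  have "generate_topology_on {{g \<in> hol_space \<Omega>. \<forall>z\<in>K. cmod (g z - f z) < e} | f K e.
        f \<in> hol_space \<Omega> \<and> compact K \<and> K \<subseteq> \<Omega> \<and> 0 < e} U"
    using assms(1) unfolding hol_topology_def openin_topology_generated_by_iff .
  then have "h \<in> U \<longrightarrow> (\<exists>K e. compact K \<and> K \<subseteq> \<Omega> \<and> 0 < e \<and> ?N K e \<subseteq> U)"
  proof induction
    case Empty
    then show ?case by simp
  next
    case (Int a b)
    show ?case
    proof
      assume "h \<in> a \<inter> b"
      then obtain K e L d where "compact K" "K \<subseteq> \<Omega>" "0 < e" "?N K e \<subseteq> a"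
        "compact L" "L \<subseteq> \<Omega>" "0 < d" "?N L d \<subseteq> b"
        using Int by auto
      then show "\<exists>K e. compact K \<and> K \<subseteq> \<Omega> \<and> 0 < e \<and> ?N K e \<subseteq> a \<inter> b"
        by (intro exI[of _ "K \<union> L"] exI[of _ "min e d"]) (auto intro!: compact_Un)
    qed
  next
    case (UN k)
    then show ?case by (meson Sup_upper UnionE subset_trans)
  next
    case (Basis s)
    show ?case
    proof
      assume "h \<in> s"
      with Basis obtain f K e where s: "s = {g \<in> hol_space \<Omega>. \<forall>z\<in>K. cmod (g z - f z) < e}"
        and f: "f \<in> hol_space \<Omega>" and K: "compact K" "K \<subseteq> \<Omega>" and e: "0 < e"
        by auto
      have h: "h \<in> hol_space \<Omega>" "\<And>z. z \<in> K \<Longrightarrow> cmod (h z - f z) < e"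
        using \<open>h \<in> s\<close> by (auto simp: s)
      have cont: "continuous_on K u" if "u \<in> hol_space \<Omega>" for u
        using that K(2) unfolding hol_space_def
        by (auto intro: holomorphic_on_imp_continuous_on holomorphic_on_subset)
      \<comment> \<open>The supremum over the compact \<open>K\<close> is attained, so it stays
        strictly below \<open>e\<close>, and the margin \<open>e - m\<close> serves as the radius
        around \<open>h\<close>. For empty \<open>K\<close> any \<open>m\<close> below
        \<open>e\<close> will do.\<close>
      obtain m where m: "m < e" "\<And>z. z \<in> K \<Longrightarrow> cmod (h z - f z) \<le> m"
      proof (cases "K = {}")
        case True
        then show ?thesis using that[of 0] e by simp
      next
        case False
        have "continuous_on K (\<lambda>z. cmod (h z - f z))"
          by (intro continuous_intros cont f h)
        then obtain w where "w \<in> K" "\<forall>z\<in>K. cmod (h z - f z) \<le> cmod (h w - f w)"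
          using continuous_attains_sup[OF K(1) False] by blast
        then show ?thesis using h(2) that by blast
      qed
      have "?N K (e - m) \<subseteq> s"
      proof
        fix g assume g: "g \<in> ?N K (e - m)"
        have "cmod (g z - f z) < e" if "z \<in> K" for z
          using g m(2)[OF that] that norm_triangle_ineq[of "g z - h z" "h z - f z"] by force
        then show "g \<in> s" using g by (simp add: s)
      qed
      then show "\<exists>K e. compact K \<and> K \<subseteq> \<Omega> \<and> 0 < e \<and> ?N K e \<subseteq> s"
        using K m(1) by (intro exI[of _ K] exI[of _ "e - m"]) auto
    qed
  qed
  then show thesis using assms(2) that by blast
qed

text \<open>Compact subsets of the plane lie in discs, so approximation on discs suffices. Requiring
  \<open>1 \<le> r\<close> costs nothing, since discs may be enlarged, and keeps the radii positive
  in later estimates.\<close>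

lemma mem_closedin_hol_topology_UNIV:
  assumes M: "closedin (hol_topology UNIV) M" and h: "h \<in> hol_space UNIV"
    and approx: "\<And>r e. 1 \<le> r \<Longrightarrow> 0 < e \<Longrightarrow> \<exists>g\<in>M. \<forall>z. cmod z \<le> r \<longrightarrow> cmod (g z - h z) < e"
  shows "h \<in> M"
proof (rule ccontr)
  assume "h \<notin> M"
  then obtain K e where K: "compact K" "0 < e"
    and sub: "{g \<in> hol_space UNIV. \<forall>z\<in>K. cmod (g z - h z) < e} \<subseteq> hol_space UNIV - M"
    using M h hol_topology_nbhdE[of UNIV "hol_space UNIV - M" h]
    by (auto simp: closedin_def)
  obtain b where "\<And>z. z \<in> K \<Longrightarrow> cmod z \<le> b"
    using compact_imp_bounded[OF K(1)] by (auto simp: bounded_iff)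
  then have "\<And>z. z \<in> K \<Longrightarrow> cmod z \<le> max 1 b" by (meson max.coboundedI2)
  moreover obtain g where "g \<in> M" "\<forall>z. cmod z \<le> max 1 b \<longrightarrow> cmod (g z - h z) < e"
    using approx[of "max 1 b" e] K(2) by auto
  moreover have "M \<subseteq> hol_space UNIV" using closedin_subset[OF M] by simp
  ultimately show False using sub by blast
qed

text \<open>For \<open>f 0 = 1\<close> this set is the line spanned by \<open>f\<close>, with
  evaluation at 0 recovering the scalar; for \<open>f = 0\<close> it is \<open>{0}\<close>. Both
  cases are used. It is closed because a violation at \<open>z\<close> is visible from the values at
  0 and \<open>z\<close> alone.\<close>

lemma closedin_hol_line:
  assumes "0 \<in> \<Omega>" and f: "f \<in> hol_space \<Omega>"
  shows "closedin (hol_topology \<Omega>) {h \<in> hol_space \<Omega>. \<forall>z. h z = h 0 * f z}" (is "closedin _ ?L")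
  unfolding closedin_def topspace_hol_topology
proof (intro conjI)
  show "openin (hol_topology \<Omega>) (hol_space \<Omega> - ?L)"
  proof (subst openin_subopen, intro ballI)
    fix h assume "h \<in> hol_space \<Omega> - ?L"
    then obtain z where h: "h \<in> hol_space \<Omega>" and z: "h z \<noteq> h 0 * f z" by auto
    have "z \<in> \<Omega>"
    proof (rule ccontr)
      assume "z \<notin> \<Omega>"
      then show False using h f z by (simp add: hol_space_def)
    qed
    \<comment> \<open>Moving the values at 0 and \<open>z\<close> by less than \<open>e\<close>
      changes \<open>h z - h 0 * f z\<close> by less than \<open>e * (1 + cmod (f z))\<close>, which
      is exactly its modulus.\<close>
    define e where "e = cmod (h z - h 0 * f z) / (1 + cmod (f z))"
    have pos: "0 < 1 + cmod (f z)" by (simp add: add_pos_nonneg)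
    have e: "0 < e" using z pos by (simp add: e_def)
    have "g \<notin> ?L" if g: "\<forall>w\<in>{0, z}. cmod (g w - h w) < e" for g
    proof
      assume "g \<in> ?L"
      then have gz: "g z = g 0 * f z" by blast
      have "h z - h 0 * f z = - (g z - h z) + (g 0 - h 0) * f z"
        by (simp add: gz algebra_simps)
      then have "cmod (h z - h 0 * f z) \<le> cmod (g z - h z) + cmod (g 0 - h 0) * cmod (f z)"
        by (metis norm_minus_cancel norm_mult norm_triangle_ineq)
      also have "\<dots> < e + e * cmod (f z)"
        using g by (intro add_less_le_mono mult_right_mono) auto
      also have "e + e * cmod (f z) = e * (1 + cmod (f z))"
        by (simp add: algebra_simps)
      also have "\<dots> = cmod (h z - h 0 * f z)"
        using pos by (simp add: e_def)
      finally show False by simp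
    qed
    then show "\<exists>T. openin (hol_topology \<Omega>) T \<and> h \<in> T \<and> T \<subseteq> hol_space \<Omega> - ?L"
      using openin_hol_topology_nbhd[OF h _ _ e, of "{0, z}"] assms \<open>z \<in> \<Omega>\<close> h e
      by (intro exI[of _ "{g \<in> hol_space \<Omega>. \<forall>w\<in>{0, z}. cmod (g w - h w) < e}"]) auto
  qed
qed auto

section \<open>Eigenvectors\<close>

lemma closed_invariant_eigenline:
  assumes \<Omega>: "open \<Omega>" "0 \<in> \<Omega>" and f: "f \<in> hol_space \<Omega>" "f 0 = 1"
    and eigen: "pommiez g\<^sub>0 f = cfun_scale \<mu> f"
  shows "closed_invariant_subspace \<Omega> (pommiez g\<^sub>0) (range (\<lambda>c. cfun_scale c f))"
    (is "closed_invariant_subspace _ _ ?R")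
proof -
  have sc: "cfun_scale c f \<in> hol_space \<Omega>" for c
    using f subspace_hol_space cfun.subspace_scale by blast
  have R: "?R = {h \<in> hol_space \<Omega>. \<forall>z. h z = h 0 * f z}"
  proof (intro equalityI subsetI)
    fix h assume "h \<in> {h \<in> hol_space \<Omega>. \<forall>z. h z = h 0 * f z}"
    then have "h = cfun_scale (h 0) f" unfolding cfun_scale_def by blast
    then show "h \<in> ?R" by blast
  qed (use sc f in \<open>auto simp: cfun_scale_def\<close>)
  have "cfun.subspace ?R"
    using cfun.span_singleton[of f] cfun.subspace_span[of "{f}"] by simp
  moreover have "pommiez g\<^sub>0 ` ?R \<subseteq> ?R"
    using pommiez_linear(2)[OF \<Omega> f(1) f(1)] eigen by auto
  ultimately show ?thesis
    using closedin_hol_line[OF \<Omega>(2) f(1)] by (simp add: closed_invariant_subspace_def R)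
qed

text \<open>Off \<open>\<Omega>\<close> the function \<open>g\<^sub>0\<close> is extended by zero, so \<open>a \<notin> \<Omega>\<close> is covered as well.\<close>

lemma hol_space_divide_zero:
  assumes \<Omega>: "open \<Omega>" and g: "g\<^sub>0 \<in> hol_space \<Omega>" and a: "g\<^sub>0 a = 0"
  obtains f where "f \<in> hol_space \<Omega>" "\<And>t. (a - t) * f t = a * g\<^sub>0 t"
proof -
  have hol: "(\<lambda>t. a * g\<^sub>0 t) holomorphic_on \<Omega>"
    using g by (auto simp: hol_space_def intro!: holomorphic_intros)
  \<comment> \<open>The quotient \<open>a * g\<^sub>0 t / (a - t)\<close> with its removable
    singularity filled in. The minus sign comes from the denominator \<open>a - t\<close> in place
    of \<open>t - a\<close>; if \<open>a\<close> lies off the domain, the value is that of the zero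
    extension.\<close>
  define f where "f = (\<lambda>t. if t = a then (if a \<in> \<Omega> then - deriv (\<lambda>t. a * g\<^sub>0 t) a else 0)
    else a * g\<^sub>0 t / (a - t))"
  have "f holomorphic_on \<Omega>"
  proof (cases "a \<in> \<Omega>")
    case True
    have "(\<lambda>t. if t = a then deriv (\<lambda>t. a * g\<^sub>0 t) a else (a * g\<^sub>0 t - a * g\<^sub>0 a) / (t - a))
        holomorphic_on \<Omega>"
      by (rule pole_theorem_open_0[OF hol \<Omega>]) (use a in auto)
    then have "(\<lambda>t. - (if t = a then deriv (\<lambda>t. a * g\<^sub>0 t) a
        else (a * g\<^sub>0 t - a * g\<^sub>0 a) / (t - a))) holomorphic_on \<Omega>"
      by (rule holomorphic_on_minus)
    also have "(\<lambda>t. - (if t = a then deriv (\<lambda>t. a * g\<^sub>0 t) a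
        else (a * g\<^sub>0 t - a * g\<^sub>0 a) / (t - a))) = f"
      using True a by (auto simp: f_def fun_eq_iff divide_simps) (simp add: algebra_simps)
    finally show ?thesis .
  next
    case False
    have "(\<lambda>t. a * g\<^sub>0 t / (a - t)) holomorphic_on \<Omega>"
      using False by (intro holomorphic_intros hol) auto
    then show ?thesis
      by (rule holomorphic_transform) (use False in \<open>auto simp: f_def\<close>)
  qed
  moreover have "f z = 0" if "z \<notin> \<Omega>" for z
    using that g by (auto simp: f_def hol_space_def)
  ultimately have "f \<in> hol_space \<Omega>" by (simp add: hol_space_def)
  moreover have "(a - t) * f t = a * g\<^sub>0 t" for t
    using a by (auto simp: f_def)
  ultimately show thesis using that by blast
qed

lemma pommiez_self:
  assumes "g\<^sub>0 0 = 1"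
  shows "pommiez g\<^sub>0 g\<^sub>0 = cfun_scale 0 g\<^sub>0"
  using assms by (auto simp: pommiez_def cfun_scale_def)

text \<open>The relation says \<open>g\<^sub>0 t = f t - t * f t / a\<close>. Since
  \<open>f 0 = 1\<close>, the numerator \<open>f t - g\<^sub>0 t * f 0\<close> equals
  \<open>t * f t / a\<close>, and division by \<open>t\<close> leaves
  \<open>f t / a\<close>.\<close>

lemma pommiez_eigenvector:
  assumes \<Omega>: "open \<Omega>" "0 \<in> \<Omega>" and g: "g\<^sub>0 0 = 1" and f: "f \<in> hol_space \<Omega>"
    and a: "a \<noteq> 0" "\<And>t. (a - t) * f t = a * g\<^sub>0 t"
  shows "f 0 = 1" and "pommiez g\<^sub>0 f = cfun_scale (1 / a) f"
proof -
  show f0: "f 0 = 1" using a(2)[of 0] a(1) g by simp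
  have geq: "g\<^sub>0 = (\<lambda>t. (a - t) * f t / a)" using a by (auto simp: fun_eq_iff field_simps)
  have df: "(f has_field_derivative deriv f 0) (at 0)"
    using f \<Omega> by (auto simp: hol_space_def intro: holomorphic_derivI)
  have "(g\<^sub>0 has_field_derivative (a * deriv f 0 - 1) / a) (at 0)"
    unfolding geq by (rule derivative_eq_intros df refl | use a f0 in simp)+
  then have "deriv g\<^sub>0 0 = (a * deriv f 0 - 1) / a" by (rule DERIV_imp_deriv)
  then have "pommiez g\<^sub>0 f 0 = 1 / a * f 0"
    using a(1) f0 by (simp add: pommiez_def field_simps)
  moreover have "pommiez g\<^sub>0 f t = 1 / a * f t" if "t \<noteq> 0" for t
    using that a(1) f0 by (simp add: pommiez_def geq field_simps)
  ultimately have "pommiez g\<^sub>0 f t = 1 / a * f t" for t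
    by (cases "t = 0") blast+
  then show "pommiez g\<^sub>0 f = cfun_scale (1 / a) f"
    unfolding cfun_scale_def by blast
qed

text \<open>The point \<open>a\<close> is arbitrary in the plane: a point off the domain is a zero
  of the extended \<open>g\<^sub>0\<close>, so this one statement excludes both genuine zeros and a
  domain smaller than the plane.\<close>

lemma unicellular_imp_nonzero:
  assumes \<Omega>: "open \<Omega>" "0 \<in> \<Omega>" and g: "g\<^sub>0 \<in> hol_space \<Omega>" "g\<^sub>0 0 = 1"
    and U: "unicellular \<Omega> (pommiez g\<^sub>0)"
  shows "g\<^sub>0 a \<noteq> 0"
proof
  assume a: "g\<^sub>0 a = 0"
  then have a0: "a \<noteq> 0" using g by auto
  obtain f where f: "f \<in> hol_space \<Omega>" "\<And>t. (a - t) * f t = a * g\<^sub>0 t"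
    using hol_space_divide_zero[OF \<Omega>(1) g(1) a] by blast
  note ev = pommiez_eigenvector[OF \<Omega> g(2) f(1) a0 f(2)]
  have "range (\<lambda>c. cfun_scale c f) \<subseteq> range (\<lambda>c. cfun_scale c g\<^sub>0) \<or>
        range (\<lambda>c. cfun_scale c g\<^sub>0) \<subseteq> range (\<lambda>c. cfun_scale c f)"
    using U closed_invariant_eigenline[OF \<Omega> f(1) ev]
      closed_invariant_eigenline[OF \<Omega> g pommiez_self[of g\<^sub>0, OF g(2)]]
    unfolding unicellular_def by blast
  moreover have "u \<in> range (\<lambda>c. cfun_scale c u)" for u
    by (rule range_eqI[of _ _ 1]) simp
  ultimately obtain c where "f = cfun_scale c g\<^sub>0 \<or> g\<^sub>0 = cfun_scale c f" by blast
  \<comment> \<open>Both functions take the value 1 at 0, which forces \<open>c = 1\<close>.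
    Comparing the eigenvalues \<open>1 / a\<close> and 0 then gives the contradiction.\<close>
  then have "f = g\<^sub>0" using ev(1) g(2) by (auto simp: cfun_scale_def fun_eq_iff)
  then have "cfun_scale (1 / a) f 0 = cfun_scale 0 g\<^sub>0 0"
    using ev(2) pommiez_self[of g\<^sub>0, OF g(2)] by (simp only:)
  then show False using a0 ev(1) by (simp add: cfun_scale_def)
qed

section \<open>Invariant subspaces when \<open>g\<^sub>0\<close> is entire without zeros\<close>

text \<open>The coefficient sequence is an explicit argument, so that the backward shift becomes a
  shift of indices.\<close>

definition entire_series :: "(nat \<Rightarrow> complex) \<Rightarrow> (complex \<Rightarrow> complex) \<Rightarrow> bool" where
  "entire_series a f \<longleftrightarrow> (\<forall>z. (\<lambda>k. a k * z ^ k) sums f z)"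

lemma hol_space_UNIV_series:
  assumes "f \<in> hol_space UNIV"
  shows "entire_series (\<lambda>k. (deriv ^^ k) f 0 / fact k) f"
  unfolding entire_series_def
proof
  fix z
  have "f holomorphic_on ball 0 (cmod z + 1)"
    using assms by (auto simp: hol_space_def intro: holomorphic_on_subset)
  from holomorphic_power_series[OF this, of z]
  show "(\<lambda>k. (deriv ^^ k) f 0 / fact k * z ^ k) sums f z" by simp
qed

lemma mult_in_hol_space_UNIV:
  "f \<in> hol_space UNIV \<Longrightarrow> g \<in> hol_space UNIV \<Longrightarrow> f * g \<in> hol_space UNIV"
  by (auto simp: hol_space_def times_fun_def intro!: holomorphic_intros)

lemma poly_in_hol_space_UNIV: "poly q \<in> hol_space UNIV"
  by (auto simp: hol_space_def intro!: holomorphic_intros)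

text \<open>Here \<open>pommiez 1\<close> is the classical backward shift, and multiplication by
  \<open>g\<^sub>0\<close> intertwines it with \<open>pommiez g\<^sub>0\<close>. Away from 0 the
  factor \<open>g\<^sub>0\<close> comes out of the numerator; at 0 the product rule yields a term
  \<open>deriv g\<^sub>0 0 * f 0\<close> that cancels.\<close>

lemma pommiez_mult_one:
  assumes g: "g\<^sub>0 \<in> hol_space UNIV" "g\<^sub>0 0 = 1" and f: "f \<in> hol_space UNIV"
  shows "pommiez g\<^sub>0 (g\<^sub>0 * f) = g\<^sub>0 * pommiez 1 f"
proof
  fix t
  have d: "(f has_field_derivative deriv f 0) (at 0)" "(g\<^sub>0 has_field_derivative deriv g\<^sub>0 0) (at 0)"
    using f g by (auto simp: hol_space_def intro: holomorphic_derivI)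
  have "deriv (g\<^sub>0 * f) 0 = deriv f 0 + deriv g\<^sub>0 0 * f 0"
    unfolding times_fun_def
    by (rule DERIV_imp_deriv) (rule derivative_eq_intros d | simp add: g)+
  then show "pommiez g\<^sub>0 (g\<^sub>0 * f) t = (g\<^sub>0 * pommiez 1 f) t"
    by (auto simp: pommiez_def g one_fun_def field_simps)
qed

lemma entire_series_pommiez_one:
  assumes f: "f \<in> hol_space UNIV" and a: "entire_series a f"
  shows "entire_series (\<lambda>k. a (Suc k)) (pommiez 1 f)"
  unfolding entire_series_def
proof
  fix z
  have s: "(\<lambda>k. a k * z ^ k) sums f z" for z using a by (simp add: entire_series_def)
  have f0: "f 0 = a 0" using s[of 0] by (metis powser_sums_zero_iff)
  show "(\<lambda>k. a (Suc k) * z ^ k) sums pommiez 1 f z"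
  proof (cases "z = 0")
    case True
    \<comment> \<open>At 0 the operator is given by a derivative instead of a quotient; termwise
      differentiation identifies it with the coefficient \<open>a 1\<close>.\<close>
    have "(f has_field_derivative (\<Sum>k. diffs a k * 0 ^ k)) (at 0)"
    proof -
      have "(\<lambda>z. \<Sum>k. a k * z ^ k) = f" using s by (auto simp: fun_eq_iff sums_iff)
      moreover have "((\<lambda>z. \<Sum>k. a k * z ^ k) has_field_derivative (\<Sum>k. diffs a k * 0 ^ k)) (at 0)"
        using sums_summable[OF s[of 1]] by (intro termdiffs_strong[of a 1]) auto
      ultimately show ?thesis by simp
    qed
    then have "deriv f 0 = a 1" by (simp add: DERIV_imp_deriv diffs_def)
    then show ?thesis using True powser_sums_zero[of "\<lambda>k. a (Suc k)"] by (simp add: pommiez_def one_fun_def)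
  next
    case False
    have "(\<lambda>k. a (Suc k) * z ^ Suc k) sums (f z - a 0)"
      using iffD2[OF sums_Suc_iff[of "\<lambda>k. a k * z ^ k"], of "f z - a 0"] s[of z] by simp
    then have "(\<lambda>k. a (Suc k) * z ^ Suc k / z) sums ((f z - a 0) / z)"
      by (rule sums_divide)
    then show ?thesis using False by (simp add: pommiez_def one_fun_def f0)
  qed
qed

lemma invariant_shift_series:
  assumes g: "g\<^sub>0 \<in> hol_space UNIV" "g\<^sub>0 0 = 1"
    and M: "closed_invariant_subspace UNIV (pommiez g\<^sub>0) M"
    and f: "f \<in> hol_space UNIV" "entire_series a f" "g\<^sub>0 * f \<in> M"
  shows "\<exists>f' \<in> hol_space UNIV. entire_series (\<lambda>k. a (k + i)) f' \<and> g\<^sub>0 * f' \<in> M"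
proof (induction i)
  case 0
  show ?case using f by (intro bexI[of _ f] conjI) (simp_all only: add_0_right)
next
  case (Suc i)
  then obtain f' where f': "f' \<in> hol_space UNIV" "entire_series (\<lambda>k. a (k + i)) f'" "g\<^sub>0 * f' \<in> M"
    by blast
  have "pommiez 1 f' \<in> hol_space UNIV"
    by (rule pommiez_in_hol_space) (use f' in \<open>auto simp: hol_space_def one_fun_def\<close>)
  moreover have "entire_series (\<lambda>k. a (k + Suc i)) (pommiez 1 f')"
    using entire_series_pommiez_one[OF f'(1,2)] by simp
  moreover have "g\<^sub>0 * pommiez 1 f' \<in> M"
    using f'(3) M pommiez_mult_one[OF g f'(1)] by (auto simp: closed_invariant_subspace_def image_subset_iff)
  ultimately show ?case by blast
qed

section \<open>Approximation inside a closed invariant subspace\<close>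

lemma subspace_mult_partial_sum:
  assumes M: "cfun.subspace M" and "\<And>k. k < n \<Longrightarrow> g * (\<lambda>z. z ^ k) \<in> M"
  shows "g * (\<lambda>z. \<Sum>k<n. b k * z ^ k) \<in> M"
  using assms(2)
proof (induction n)
  case 0
  have "g * (\<lambda>z. \<Sum>k<0. b k * z ^ k) = 0" by (auto simp: fun_eq_iff)
  then show ?case using cfun.subspace_0[OF M] by (simp only:)
next
  case (Suc n)
  have "g * (\<lambda>z. \<Sum>k<Suc n. b k * z ^ k) =
      g * (\<lambda>z. \<Sum>k<n. b k * z ^ k) + cfun_scale (b n) (g * (\<lambda>z. z ^ n))"
    by (auto simp: fun_eq_iff cfun_scale_def algebra_simps)
  moreover have "g * (\<lambda>z. \<Sum>k<n. b k * z ^ k) \<in> M"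
    by (rule Suc.IH) (rule Suc.prems, erule less_SucI)
  ultimately show ?case
    using cfun.subspace_add[OF M _ cfun.subspace_scale[OF M Suc.prems[OF lessI]]] by (simp only:)
qed

text \<open>The factor \<open>g\<close> is bounded on each disc, so it suffices to approximate the
  cofactor \<open>h\<close>.\<close>

lemma mult_mem_closedin_hol_topology_UNIV:
  assumes M: "closedin (hol_topology UNIV) M" and h: "g \<in> hol_space UNIV" "h \<in> hol_space UNIV"
    and approx: "\<And>r e. 1 \<le> r \<Longrightarrow> 0 < e \<Longrightarrow> \<exists>u. g * u \<in> M \<and> (\<forall>z. cmod z \<le> r \<longrightarrow> cmod (u z - h z) \<le> e)"
  shows "g * h \<in> M"
proof (rule mem_closedin_hol_topology_UNIV[OF M mult_in_hol_space_UNIV[OF h]])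
  fix r e :: real assume r: "1 \<le> r" and e: "0 < e"
  have "continuous_on (cball 0 r) g"
    using h(1) by (auto simp: hol_space_def intro: holomorphic_on_imp_continuous_on holomorphic_on_subset)
  then have "bounded (g ` cball 0 r)"
    by (intro compact_imp_bounded compact_continuous_image) auto
  then obtain B where B: "0 < B" "\<And>z. cmod z \<le> r \<Longrightarrow> cmod (g z) \<le> B"
    by (auto simp: bounded_pos)
  \<comment> \<open>The factor 2 turns the weak bound of the hypothesis into the strict one required
    for a neighbourhood.\<close>
  obtain u where u: "g * u \<in> M" "\<And>z. cmod z \<le> r \<Longrightarrow> cmod (u z - h z) \<le> e / (2 * B)"
    using approx[OF r, of "e / (2 * B)"] e B by auto
  have "cmod ((g * u) z - (g * h) z) < e" if z: "cmod z \<le> r" for z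
  proof -
    have "cmod ((g * u) z - (g * h) z) = cmod (g z) * cmod (u z - h z)"
      by (simp flip: norm_mult add: algebra_simps)
    also have "\<dots> \<le> B * (e / (2 * B))"
      using B u z by (intro mult_mono) auto
    also have "\<dots> < e" using B e by simp
    finally show ?thesis .
  qed
  then show "\<exists>u\<in>M. \<forall>z. cmod z \<le> r \<longrightarrow> cmod (u z - (g * h) z) < e" using u(1) by blast
qed

text \<open>The weights \<open>cmod (a k) * R ^ k\<close> tend to 0, so they attain a maximum over
  \<open>k \<ge> m\<close>. At a maximiser \<open>j\<close>, later coefficients decay geometrically
  relative to \<open>a j\<close>.\<close>

lemma exists_max_weighted_coeff:
  fixes a :: "nat \<Rightarrow> complex"
  assumes lim: "(\<lambda>k. a k * complex_of_real R ^ k) \<longlonglongrightarrow> 0" and R: "0 < R" and am: "a m \<noteq> 0"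
  obtains j where "m \<le> j" "a j \<noteq> 0" "\<And>l. cmod (a (j + l)) * R ^ l \<le> cmod (a j)"
proof -
  define w where "w k = cmod (a k) * R ^ k" for k
  have w: "w \<longlonglongrightarrow> 0"
    using tendsto_norm[OF lim] R by (simp add: w_def[abs_def] norm_mult norm_power)
  have wm: "0 < w m" using R am by (simp add: w_def)
  \<comment> \<open>A finite set containing \<open>m\<close>. Indices from \<open>m\<close> on that
    lie outside it have weight below \<open>w m\<close>, so a maximum over \<open>S\<close> is a
    maximum over all \<open>k \<ge> m\<close>.\<close>
  define S where "S = {k. m \<le> k \<and> w m \<le> w k}"
  have "\<forall>\<^sub>F k in sequentially. w k < w m" using order_tendstoD(2)[OF w wm] .
  then obtain N where "\<And>k. N \<le> k \<Longrightarrow> w k < w m" by (auto simp: eventually_sequentially)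
  then have "S \<subseteq> {..<N}" by (force simp: S_def not_le[symmetric])
  then have S: "finite S" "m \<in> S" by (auto simp: S_def finite_subset)
  obtain j where j: "j \<in> S" "\<And>k. k \<in> S \<Longrightarrow> w k \<le> w j"
    using S Max_in[of "w ` S"] Max_ge[of "w ` S"] by (metis (no_types, lifting) empty_iff finite_imageI image_iff imageI)
  have max: "w k \<le> w j" if "m \<le> k" for k
    using j that by (cases "w m \<le> w k") (force simp: S_def)+
  show thesis
  proof
    show "m \<le> j" using j by (simp add: S_def)
    show "a j \<noteq> 0" using j(1) wm by (auto simp: S_def w_def[of j])
    fix l
    have "cmod (a (j + l)) * R ^ l * R ^ j \<le> cmod (a j) * R ^ j"
      using max[of "j + l"] \<open>m \<le> j\<close> by (simp add: w_def power_add mult_ac)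
    then show "cmod (a (j + l)) * R ^ l \<le> cmod (a j)" using R by simp
  qed
qed

text \<open>The index \<open>j\<close> depends on \<open>r\<close> and \<open>e\<close> through
  \<open>R\<close>, so each approximant comes from its own shift of \<open>f\<close>; closedness of
  \<open>M\<close> supplies the limit. The induction hypothesis pays for removing the terms of
  degree below \<open>n\<close>.\<close>

lemma invariant_contains_power:
  assumes g: "g\<^sub>0 \<in> hol_space UNIV" "g\<^sub>0 0 = 1"
    and M: "closed_invariant_subspace UNIV (pommiez g\<^sub>0) M"
    and f: "f \<in> hol_space UNIV" "entire_series a f" "g\<^sub>0 * f \<in> M"
    and am: "a m \<noteq> 0"
  shows "n \<le> m \<Longrightarrow> g\<^sub>0 * (\<lambda>z. z ^ n) \<in> M"
proof (induction n rule: less_induct)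
  case (less n)
  have sub: "cfun.subspace M" and cl: "closedin (hol_topology UNIV) M"
    using M by (auto simp: closed_invariant_subspace_def)
  have pow: "(\<lambda>z. z ^ n) \<in> hol_space UNIV" by (auto simp: hol_space_def intro!: holomorphic_intros)
  show ?case
  proof (rule mult_mem_closedin_hol_topology_UNIV[OF cl g(1) pow])
    fix r e :: real assume r: "1 \<le> r" and e: "0 < e"
    \<comment> \<open>The first summand makes \<open>r / R \<le> 1 / 2\<close>; the second makes the
      final bound \<open>2 * r ^ Suc n / R\<close> at most \<open>e\<close>.\<close>
    define R where "R = 2 * r + 2 * r ^ Suc n / e"
    have R: "2 * r \<le> R" "2 * r ^ Suc n / e \<le> R" "0 < R"
      using r e by (auto simp: R_def add_pos_nonneg)
    have "(\<lambda>k. a k * complex_of_real R ^ k) \<longlonglongrightarrow> 0"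
      using f(2) unfolding entire_series_def by (intro summable_LIMSEQ_zero) (auto simp: sums_iff)
    then obtain j where j: "m \<le> j" "a j \<noteq> 0" "\<And>l. cmod (a (j + l)) * R ^ l \<le> cmod (a j)"
      using exists_max_weighted_coeff[of a R m] R(3) am by blast
    obtain i where i: "j = i + n" using j(1) less.prems le_Suc_ex[of n j] by (auto simp: add.commute)
    obtain f' where f': "entire_series (\<lambda>k. a (k + i)) f'" "g\<^sub>0 * f' \<in> M"
      using invariant_shift_series[OF g M f] by blast
    \<comment> \<open>Cancels the terms of degree below \<open>n\<close> of the shifted series
      \<open>f'\<close>.\<close>
    define p where "p = (\<lambda>z. \<Sum>k<n. (- a (k + i)) * z ^ k)"
    have p: "g\<^sub>0 * p \<in> M"
      unfolding p_def using less.IH less.prems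
      by (intro subspace_mult_partial_sum[OF sub]) (meson less_imp_le order_trans)
    define u where "u = (\<lambda>z. (f' z + p z) / a j)"
    have "g\<^sub>0 * u = cfun_scale (1 / a j) (g\<^sub>0 * f' + g\<^sub>0 * p)"
      by (auto simp: u_def cfun_scale_def fun_eq_iff field_simps)
    then have "g\<^sub>0 * u \<in> M"
      using p f'(2) sub by (simp add: cfun.subspace_add cfun.subspace_scale)
    moreover have "cmod (u z - z ^ n) \<le> e" if z: "cmod z \<le> r" for z
    proof -
      have "(\<lambda>k. a (k + i) * z ^ k) sums f' z" using f'(1) by (simp add: entire_series_def)
      \<comment> \<open>Of the \<open>Suc n\<close> terms split off, the first \<open>n\<close> are
        cancelled by \<open>p\<close>, and the last is \<open>a j * z ^ n\<close> because
        \<open>j = i + n\<close>.\<close>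
      from sums_split_initial_segment[OF this, of "Suc n"]
      have "(\<lambda>l. a (l + Suc n + i) * z ^ (l + Suc n)) sums (f' z + p z - a j * z ^ n)"
        by (simp add: p_def i sum_negf algebra_simps)
      then have "(\<lambda>l. a (l + Suc n + i) * z ^ (l + Suc n) / a j) sums ((f' z + p z - a j * z ^ n) / a j)"
        by (rule sums_divide)
      moreover have "(f' z + p z - a j * z ^ n) / a j = u z - z ^ n"
        using j(2) by (simp add: u_def field_simps)
      ultimately have s: "(\<lambda>l. a (l + Suc n + i) * z ^ (l + Suc n) / a j) sums (u z - z ^ n)" by simp
      define q where "q = r / R"
      have q: "0 \<le> q" "q \<le> 1 / 2" using r R by (auto simp: q_def field_simps)
      have gs: "(\<lambda>l. r ^ n * (q * q ^ l)) sums (r ^ n * (q * (1 / (1 - q))))"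
        using q by (intro sums_mult geometric_sums) auto
      have "cmod (u z - z ^ n) \<le> r ^ n * (q * (1 / (1 - q)))"
      proof (rule norm_sums_le[OF s gs])
        fix l
        \<comment> \<open>The tail coefficient has index \<open>j + Suc l\<close>, so the maximality
          of \<open>j\<close> applies with exponent \<open>Suc l\<close>.\<close>
        have "cmod (a (l + Suc n + i)) / cmod (a j) \<le> 1 / R ^ Suc l"
          using j(3)[of "Suc l"] j(2) R(3) by (simp add: i field_simps add_ac)
        moreover have "cmod z ^ (l + Suc n) \<le> r ^ (l + Suc n)" using z by (intro power_mono) auto
        ultimately have "cmod (a (l + Suc n + i)) / cmod (a j) * cmod z ^ (l + Suc n)
            \<le> 1 / R ^ Suc l * r ^ (l + Suc n)"
          using R(3) by (intro mult_mono) auto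
        also have "\<dots> = r ^ n * (q * q ^ l)" by (simp add: q_def power_divide power_add)
        finally show "cmod (a (l + Suc n + i) * z ^ (l + Suc n) / a j) \<le> r ^ n * (q * q ^ l)"
          by (simp add: norm_mult norm_divide norm_power)
      qed
      also have "\<dots> \<le> r ^ n * (q * 2)"
        using q r by (intro mult_left_mono) (auto simp: field_simps)
      also have "\<dots> \<le> e"
        using R r e by (simp add: q_def field_simps)
      finally show ?thesis .
    qed
    ultimately show "\<exists>u. g\<^sub>0 * u \<in> M \<and> (\<forall>z. cmod z \<le> r \<longrightarrow> cmod (u z - z ^ n) \<le> e)" by blast
  qed
qed

lemma closed_contains_powers_imp_all:
  assumes g: "g\<^sub>0 \<in> hol_space UNIV" and f: "f \<in> hol_space UNIV"
    and M: "cfun.subspace M" "closedin (hol_topology UNIV) M"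
    and pow: "\<And>n. g\<^sub>0 * (\<lambda>z. z ^ n) \<in> M"
  shows "g\<^sub>0 * f \<in> M"
proof (rule mult_mem_closedin_hol_topology_UNIV[OF M(2) g f])
  fix r e :: real assume r: "1 \<le> r" and e: "0 < e"
  define a where "a = (\<lambda>k. (deriv ^^ k) f 0 / fact k)"
  have a: "(\<lambda>k. a k * z ^ k) sums f z" for z
    using hol_space_UNIV_series[OF f] by (simp add: entire_series_def a_def)
  \<comment> \<open>Convergence at the larger point \<open>r + 1\<close> gives absolute convergence
    at \<open>r\<close>; this majorises the Taylor tails uniformly on the disc.\<close>
  have sm: "summable (\<lambda>k. norm (a k * complex_of_real r ^ k))"
    by (rule powser_insidea[of a "complex_of_real (r + 1)"]) (use a r in \<open>auto simp: sums_iff\<close>)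
  obtain N where N: "norm (\<Sum>k. norm (a (k + N) * complex_of_real r ^ (k + N))) < e"
    using suminf_exist_split[OF e sm] by auto
  have "cmod ((\<Sum>k<N. a k * z ^ k) - f z) \<le> e" if z: "cmod z \<le> r" for z
  proof -
    have "cmod (f z - (\<Sum>k<N. a k * z ^ k)) \<le> (\<Sum>k. norm (a (k + N) * complex_of_real r ^ (k + N)))"
    proof (rule norm_sums_le)
      show "(\<lambda>k. a (k + N) * z ^ (k + N)) sums (f z - (\<Sum>k<N. a k * z ^ k))"
        by (rule sums_split_initial_segment[OF a])
      show "(\<lambda>k. norm (a (k + N) * complex_of_real r ^ (k + N))) sums
          (\<Sum>k. norm (a (k + N) * complex_of_real r ^ (k + N)))"
        using summable_ignore_initial_segment[OF sm, of N] by (rule summable_sums)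
      show "norm (a (k + N) * z ^ (k + N)) \<le> norm (a (k + N) * complex_of_real r ^ (k + N))" for k
        using z r by (simp add: norm_mult norm_power mult_left_mono power_mono)
    qed
    then show ?thesis using N by (simp add: norm_minus_commute)
  qed
  then show "\<exists>u. g\<^sub>0 * u \<in> M \<and> (\<forall>z. cmod z \<le> r \<longrightarrow> cmod (u z - f z) \<le> e)"
    using subspace_mult_partial_sum[OF M(1) pow] by blast
qed

section \<open>Classification of the closed invariant subspaces\<close>

lemma closed_invariant_cases:
  assumes g: "g\<^sub>0 \<in> hol_space UNIV" "g\<^sub>0 0 = 1" "\<And>z. g\<^sub>0 z \<noteq> 0"
    and M: "closed_invariant_subspace UNIV (pommiez g\<^sub>0) M"
  shows "M = {0} \<or> M = hol_space UNIV \<or> (\<exists>n. M = poly_multiples g\<^sub>0 n)"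
proof -
  have sub: "cfun.subspace M" and cl: "closedin (hol_topology UNIV) M"
    using M by (auto simp: closed_invariant_subspace_def)
  have MH: "M \<subseteq> hol_space UNIV" using closedin_subset[OF cl] by simp
  have fac: "\<exists>f\<in>hol_space UNIV. h = g\<^sub>0 * f" if "h \<in> hol_space UNIV" for h
  proof
    show "(\<lambda>z. h z / g\<^sub>0 z) \<in> hol_space UNIV"
      using that g by (auto simp: hol_space_def intro!: holomorphic_intros)
    show "h = g\<^sub>0 * (\<lambda>z. h z / g\<^sub>0 z)" using g(3) by (auto simp: fun_eq_iff)
  qed
  \<comment> \<open>The indices at which some cofactor of an element of \<open>M\<close> has a
    nonzero coefficient. Whether this set is empty, infinite, or finite with maximum
    \<open>n\<close> decides which alternative holds.\<close>
  define S where "S = {n. \<exists>a f. f \<in> hol_space UNIV \<and> entire_series a f \<and> g\<^sub>0 * f \<in> M \<and> a n \<noteq> 0}"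
  have pow: "g\<^sub>0 * (\<lambda>z. z ^ n) \<in> M" if "m \<in> S" "n \<le> m" for m n
    using that invariant_contains_power[OF g(1,2) M] unfolding S_def by blast
  have fin: "g\<^sub>0 * (\<lambda>z. \<Sum>k<n. b k * z ^ k) \<in> M" if "n = 0 \<or> n - 1 \<in> S" for n b
    using that pow by (intro subspace_mult_partial_sum[OF sub]) auto
  \<comment> \<open>If \<open>S\<close> lies below \<open>n\<close>, all coefficients from
    \<open>n\<close> on vanish and the cofactor is a polynomial; \<open>n = 0\<close> gives the zero
    function.\<close>
  have trunc: "\<exists>b. h = g\<^sub>0 * (\<lambda>z. \<Sum>k<n. b k * z ^ k)" if h: "h \<in> M" and n: "\<And>k. k \<in> S \<Longrightarrow> k < n" for h n
  proof -
    obtain f where f: "f \<in> hol_space UNIV" "h = g\<^sub>0 * f" using h MH fac by blast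
    obtain a where a: "entire_series a f" using hol_space_UNIV_series[OF f(1)] by blast
    have zero: "a k = 0" if "k \<notin> {..<n}" for k
      using that n[of k] f a h unfolding S_def by blast
    have "f z = (\<Sum>k<n. a k * z ^ k)" for z
    proof -
      have "(\<lambda>k. a k * z ^ k) sums (\<Sum>k<n. a k * z ^ k)"
        by (rule sums_finite) (use zero in auto)
      then show ?thesis using a by (metis entire_series_def sums_unique2)
    qed
    then have "h = g\<^sub>0 * (\<lambda>z. \<Sum>k<n. a k * z ^ k)" by (auto simp: f fun_eq_iff)
    then show ?thesis by blast
  qed
  consider "S = {}" | "infinite S" | "finite S" "S \<noteq> {}" by blast
  then show ?thesis
  proof cases
    case 1
    then have "h = 0" if "h \<in> M" for h
      using trunc[OF that, of 0] by (auto simp: fun_eq_iff)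
    then show ?thesis using cfun.subspace_0[OF sub] by blast
  next
    case 2
    then have "g\<^sub>0 * (\<lambda>z. z ^ n) \<in> M" for n
      using pow by (meson infinite_nat_iff_unbounded_le)
    then have "hol_space UNIV \<subseteq> M"
      using closed_contains_powers_imp_all[OF g(1) _ sub cl] fac by blast
    then show ?thesis using MH by blast
  next
    case 3
    define n where "n = Max S"
    have n: "n \<in> S" "\<And>k. k \<in> S \<Longrightarrow> k < Suc n" using 3 by (auto simp: n_def less_Suc_eq_le)
    have "M = poly_multiples g\<^sub>0 n"
    proof (intro equalityI subsetI)
      fix h assume "h \<in> M"
      then obtain b where b: "h = g\<^sub>0 * (\<lambda>z. \<Sum>k<Suc n. b k * z ^ k)" using trunc n(2) by blast
      define q where "q = (\<Sum>k<Suc n. monom (b k) k)"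
      have "degree q \<le> n"
        unfolding q_def by (intro degree_sum_le) (auto intro: order_trans[OF degree_monom_le])
      moreover have "h = g\<^sub>0 * poly q" by (auto simp: b q_def poly_sum poly_monom fun_eq_iff simp del: sum.lessThan_Suc)
      ultimately show "h \<in> poly_multiples g\<^sub>0 n" by (auto simp: poly_multiples_def)
    next
      fix h assume "h \<in> poly_multiples g\<^sub>0 n"
      then obtain q where q: "h = g\<^sub>0 * poly q" "degree q \<le> n" by (auto simp: poly_multiples_def)
      have "poly q z = (\<Sum>k<Suc n. coeff q k * z ^ k)" for z
        unfolding poly_altdef using q(2) by (intro sum.mono_neutral_left) (auto simp: coeff_eq_0)
      then have "poly q = (\<lambda>z. \<Sum>k<Suc n. coeff q k * z ^ k)" by blast
      then show "h \<in> M" unfolding q(1) using fin[of "Suc n" "coeff q"] n(1) by simp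
    qed
    then show ?thesis by blast
  qed
qed

section \<open>The subspaces \<open>g\<^sub>0 \<complex>[z]\<^sub>n\<close>\<close>

lemma subspace_poly_multiples: "cfun.subspace (poly_multiples g\<^sub>0 n)"
  unfolding cfun.subspace_def
proof (intro conjI ballI allI)
  show "0 \<in> poly_multiples g\<^sub>0 n"
    unfolding poly_multiples_def by (rule CollectI, rule exI[of _ 0]) (auto simp: fun_eq_iff)
next
  fix f h assume "f \<in> poly_multiples g\<^sub>0 n" "h \<in> poly_multiples g\<^sub>0 n"
  then obtain p q where "f = g\<^sub>0 * poly p" "h = g\<^sub>0 * poly q" "degree p \<le> n" "degree q \<le> n"
    by (auto simp: poly_multiples_def)
  then show "f + h \<in> poly_multiples g\<^sub>0 n"
    unfolding poly_multiples_def
    by (intro CollectI exI[of _ "p + q"]) (auto simp: fun_eq_iff algebra_simps degree_add_le)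
next
  fix c f assume "f \<in> poly_multiples g\<^sub>0 n"
  then obtain p where "f = g\<^sub>0 * poly p" "degree p \<le> n"
    by (auto simp: poly_multiples_def)
  then show "cfun_scale c f \<in> poly_multiples g\<^sub>0 n"
    unfolding poly_multiples_def
    by (intro CollectI exI[of _ "smult c p"]) (auto simp: fun_eq_iff cfun_scale_def)
qed

lemma poly_multiples_mono: "m \<le> n \<Longrightarrow> poly_multiples g\<^sub>0 m \<subseteq> poly_multiples g\<^sub>0 n"
  by (auto simp: poly_multiples_def intro: order_trans)

lemma pommiez_mult_poly:
  assumes g: "g\<^sub>0 \<in> hol_space UNIV" "g\<^sub>0 0 = 1"
  shows "pommiez g\<^sub>0 (g\<^sub>0 * poly (pCons c q)) = g\<^sub>0 * poly q"
proof -
  have "deriv (poly (pCons c q)) 0 = poly q 0"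
    by (rule DERIV_imp_deriv) (rule derivative_eq_intros poly_DERIV | simp add: pderiv_pCons)+
  then have "pommiez 1 (poly (pCons c q)) = poly q"
    by (auto simp: pommiez_def one_fun_def fun_eq_iff)
  then show ?thesis using pommiez_mult_one[OF g poly_in_hol_space_UNIV] by simp
qed

text \<open>For \<open>t \<noteq> 0\<close> the defining quotient is solved for \<open>h t\<close>,
  giving \<open>g\<^sub>0 t * (h 0 + t * poly q t)\<close>; at 0 the normalisation of
  \<open>g\<^sub>0\<close> suffices.\<close>

lemma recover_from_pommiez:
  assumes "g\<^sub>0 0 = 1" "pommiez g\<^sub>0 h = g\<^sub>0 * poly q"
  shows "h = g\<^sub>0 * poly (pCons (h 0) q)"
proof
  fix t
  show "h t = (g\<^sub>0 * poly (pCons (h 0) q)) t"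
    using fun_cong[OF assms(2), of t] assms(1)
    by (cases "t = 0") (auto simp: pommiez_def field_simps)
qed

text \<open>These spaces are the kernels of the powers of the operator. Writing them as successive
  preimages of \<open>{0}\<close> lets closedness follow from continuity.\<close>

lemma poly_multiples_kernel:
  assumes g: "g\<^sub>0 \<in> hol_space UNIV" "g\<^sub>0 0 = 1"
  shows "poly_multiples g\<^sub>0 0 = {h \<in> hol_space UNIV. pommiez g\<^sub>0 h \<in> {0}}" (is ?zero)
    and "poly_multiples g\<^sub>0 (Suc n) = {h \<in> hol_space UNIV. pommiez g\<^sub>0 h \<in> poly_multiples g\<^sub>0 n}" (is ?Suc)
proof -
  have H: "g\<^sub>0 * poly q \<in> hol_space UNIV" for q
    by (intro mult_in_hol_space_UNIV g poly_in_hol_space_UNIV)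
  show ?zero
  proof (intro equalityI subsetI)
    fix h assume "h \<in> poly_multiples g\<^sub>0 0"
    then obtain q where q: "h = g\<^sub>0 * poly q" "degree q = 0" by (auto simp: poly_multiples_def)
    then obtain c where "q = pCons c 0" by (meson degree_eq_zeroE)
    then show "h \<in> {h \<in> hol_space UNIV. pommiez g\<^sub>0 h \<in> {0}}"
      using q(1) H[of q] pommiez_mult_poly[OF g, of c 0] by (simp add: zero_fun_def times_fun_def)
  next
    fix h assume "h \<in> {h \<in> hol_space UNIV. pommiez g\<^sub>0 h \<in> {0}}"
    then have "pommiez g\<^sub>0 h = g\<^sub>0 * poly 0" by (auto simp: fun_eq_iff)
    from recover_from_pommiez[OF g(2) this] show "h \<in> poly_multiples g\<^sub>0 0"
      unfolding poly_multiples_def by (intro CollectI exI[of _ "[:h 0:]"]) auto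
  qed
  show ?Suc
  proof (intro equalityI subsetI)
    fix h assume "h \<in> poly_multiples g\<^sub>0 (Suc n)"
    then obtain q where q: "h = g\<^sub>0 * poly q" "degree q \<le> Suc n" by (auto simp: poly_multiples_def)
    obtain c p where p: "q = pCons c p" by (cases q)
    have "degree p \<le> n" using q(2) by (auto simp: p split: if_splits)
    then show "h \<in> {h \<in> hol_space UNIV. pommiez g\<^sub>0 h \<in> poly_multiples g\<^sub>0 n}"
      using q(1) H[of q] pommiez_mult_poly[OF g, of c p] by (auto simp: p poly_multiples_def)
  next
    fix h assume "h \<in> {h \<in> hol_space UNIV. pommiez g\<^sub>0 h \<in> poly_multiples g\<^sub>0 n}"
    then obtain q where q: "pommiez g\<^sub>0 h = g\<^sub>0 * poly q" "degree q \<le> n"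
      by (auto simp: poly_multiples_def)
    have "degree (pCons (h 0) q) \<le> Suc n"
      using q(2) by (meson Suc_le_mono degree_pCons_le order_trans)
    with recover_from_pommiez[OF g(2) q(1)] show "h \<in> poly_multiples g\<^sub>0 (Suc n)"
      unfolding poly_multiples_def by blast
  qed
qed

lemma closed_invariant_poly_multiples:
  assumes g: "g\<^sub>0 \<in> hol_space UNIV" "g\<^sub>0 0 = 1"
  shows "closed_invariant_subspace UNIV (pommiez g\<^sub>0) (poly_multiples g\<^sub>0 n)"
proof -
  have pre: "closedin (hol_topology UNIV) {h \<in> hol_space UNIV. pommiez g\<^sub>0 h \<in> C}"
    if "closedin (hol_topology UNIV) C" for C
    using closedin_continuous_map_preimage[OF _ that, of "hol_topology UNIV" "pommiez g\<^sub>0"]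
      pommiez_continuous_linear[of UNIV g\<^sub>0] g
    by (simp add: continuous_linear_operator_def)
  have zero: "0 \<in> hol_space UNIV" using subspace_hol_space cfun.subspace_0 by blast
  \<comment> \<open>The degenerate line with \<open>f = 0\<close>, which shows that
    \<open>{0}\<close> is closed.\<close>
  have "{h \<in> hol_space UNIV. \<forall>z. h z = h 0 * (0 :: complex \<Rightarrow> complex) z} = {0}"
    using zero by (auto simp: fun_eq_iff)
  then have zero_closed: "closedin (hol_topology UNIV) {0}"
    using closedin_hol_line[OF _ zero] by simp
  have "closedin (hol_topology UNIV) (poly_multiples g\<^sub>0 n)"
  proof (induction n)
    case 0
    then show ?case unfolding poly_multiples_kernel(1)[OF g] by (rule pre[OF zero_closed])
  next
    case (Suc n)
    then show ?case unfolding poly_multiples_kernel(2)[OF g] by (rule pre)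
  qed
  \<comment> \<open>The space of index \<open>n\<close> lies in that of index \<open>Suc n\<close>,
    which is its own preimage under the operator.\<close>
  moreover have "pommiez g\<^sub>0 ` poly_multiples g\<^sub>0 n \<subseteq> poly_multiples g\<^sub>0 n"
    using poly_multiples_kernel(2)[OF g, of n] poly_multiples_mono[of n "Suc n" g\<^sub>0] by auto
  ultimately show ?thesis
    by (simp add: closed_invariant_subspace_def subspace_poly_multiples)
qed

lemma proper_poly_multiples:
  assumes g: "g\<^sub>0 \<in> hol_space UNIV" "\<And>z. g\<^sub>0 z \<noteq> 0"
  shows "proper_subspace UNIV (poly_multiples g\<^sub>0 n)"
proof -
  have H: "g\<^sub>0 * poly q \<in> hol_space UNIV" for q
    by (intro mult_in_hol_space_UNIV g poly_in_hol_space_UNIV)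
  have "g\<^sub>0 * poly 1 \<in> poly_multiples g\<^sub>0 n"
    unfolding poly_multiples_def by (intro CollectI exI[of _ 1]) auto
  moreover have "g\<^sub>0 * poly 1 \<noteq> 0" using g(2) by (auto simp: fun_eq_iff)
  \<comment> \<open>A witness outside the subspace: the nonvanishing factor \<open>g\<^sub>0\<close>
    cancels, and the degrees disagree.\<close>
  moreover have "g\<^sub>0 * poly (monom 1 (Suc n)) \<notin> poly_multiples g\<^sub>0 n"
  proof
    assume "g\<^sub>0 * poly (monom 1 (Suc n)) \<in> poly_multiples g\<^sub>0 n"
    then obtain q where q: "g\<^sub>0 * poly (monom 1 (Suc n)) = g\<^sub>0 * poly q" "degree q \<le> n"
      by (auto simp: poly_multiples_def)
    have "poly (monom 1 (Suc n)) z = poly q z" for z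
      using fun_cong[OF q(1), of z] g(2)[of z] by simp
    then have "monom 1 (Suc n) = q" by (intro iffD1[OF poly_eq_poly_eq_iff] ext)
    then show False using q(2) by (auto simp: degree_monom_eq)
  qed
  ultimately show ?thesis
    using H subspace_poly_multiples[of g\<^sub>0 n]
    unfolding proper_subspace_def by (auto simp: poly_multiples_def)
qed

section \<open>Unicellularity and the final equivalence\<close>

lemma nonzero_imp_unicellular:
  assumes g: "g\<^sub>0 \<in> hol_space UNIV" "g\<^sub>0 0 = 1" "\<And>z. g\<^sub>0 z \<noteq> 0"
  shows "unicellular UNIV (pommiez g\<^sub>0)"
  unfolding unicellular_def
proof (intro conjI allI impI)
  show "continuous_linear_operator UNIV (pommiez g\<^sub>0)"
    using pommiez_continuous_linear[of UNIV g\<^sub>0] g by simp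
next
  fix M N
  assume MN: "closed_invariant_subspace UNIV (pommiez g\<^sub>0) M \<and>
    closed_invariant_subspace UNIV (pommiez g\<^sub>0) N"
  then have "0 \<in> M" "0 \<in> N" "M \<subseteq> hol_space UNIV" "N \<subseteq> hol_space UNIV"
    using closedin_subset[of "hol_topology UNIV"]
    by (auto simp: closed_invariant_subspace_def cfun.subspace_0)
  moreover have "poly_multiples g\<^sub>0 m \<subseteq> poly_multiples g\<^sub>0 n \<or>
      poly_multiples g\<^sub>0 n \<subseteq> poly_multiples g\<^sub>0 m" for m n
    using poly_multiples_mono nat_le_linear by metis
  ultimately show "M \<subseteq> N \<or> N \<subseteq> M"
    using closed_invariant_cases[OF g] MN by (metis empty_subsetI insert_subset)
qed

theorem mainTheorem4:
  fixes \<Omega> :: "complex set" and g\<^sub>0 :: "complex \<Rightarrow> complex"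
  assumes "open \<Omega>" and "connected \<Omega>" and "simply_connected \<Omega>" and "0 \<in> \<Omega>"
    and "g\<^sub>0 \<in> hol_space \<Omega>" and "g\<^sub>0 0 = 1"
  shows "(unicellular \<Omega> (pommiez g\<^sub>0) \<longleftrightarrow> \<Omega> = UNIV \<and> (\<forall>z. g\<^sub>0 z \<noteq> 0)) \<and>
         (unicellular \<Omega> (pommiez g\<^sub>0) \<longrightarrow>
            (\<forall>M. closed_invariant_subspace \<Omega> (pommiez g\<^sub>0) M \<and> proper_subspace \<Omega> M \<longleftrightarrow>
                 (\<exists>n::nat. M = poly_multiples g\<^sub>0 n)))"
proof -
  \<comment> \<open>The extended \<open>g\<^sub>0\<close> vanishes off the domain, so having no zero
    anywhere in the plane already forces the domain to be the whole plane.\<close>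
  have UNIV: "\<Omega> = UNIV \<and> (\<forall>z. g\<^sub>0 z \<noteq> 0)" if "unicellular \<Omega> (pommiez g\<^sub>0)"
    using unicellular_imp_nonzero[OF assms(1,4-6) that] assms(5) by (auto simp: hol_space_def)
  have subspaces: "closed_invariant_subspace \<Omega> (pommiez g\<^sub>0) M \<and> proper_subspace \<Omega> M \<longleftrightarrow>
      (\<exists>n::nat. M = poly_multiples g\<^sub>0 n)" if "unicellular \<Omega> (pommiez g\<^sub>0)" for M
  proof -
    have \<Omega>: "\<Omega> = UNIV" and nz: "\<And>z. g\<^sub>0 z \<noteq> 0" using UNIV[OF that] by auto
    note g = assms(5)[unfolded \<Omega>] assms(6)
    show ?thesis
      unfolding \<Omega>
      using closed_invariant_cases[OF g nz, of M] closed_invariant_poly_multiples[OF g]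
        proper_poly_multiples[OF g(1) nz] proper_subspace_def
      by metis
  qed
  have "unicellular \<Omega> (pommiez g\<^sub>0)" if "\<Omega> = UNIV \<and> (\<forall>z. g\<^sub>0 z \<noteq> 0)"
    using that assms(5,6) nonzero_imp_unicellular[of g\<^sub>0] by simp
  then have "unicellular \<Omega> (pommiez g\<^sub>0) \<longleftrightarrow> \<Omega> = UNIV \<and> (\<forall>z. g\<^sub>0 z \<noteq> 0)"
    using UNIV by (rule iffI[rotated])
  then show ?thesis
    by (rule conjI) (intro impI allI subspaces)
qed

end
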